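(* Let $G=(V,E)$ be a finite one-way Sperner directed metric graph with source $s$, having $\beta\ge 1$ elementary cycles $c_1,\dots,c_\beta$, and assume that the passage times $t(c_1),\dots,t(c_\beta)$ together with the passage times $t(l_v)$, $v\in V\setminus\{s\}$, of the simple chains from $s$ are linearly independent over $\mathbb{Q}$. Let $N(T)$ be the number of possible endpoints at time $T$ of the walk on $G$ starting at $s$ at time $0$. Then, as $T\to\infty$, \[ N(T)=\frac{T^{\beta-1}}{(\beta-1)!}\cdot\frac{\sum_{e\in E}t(e)}{\prod_{j=1}^{\beta}t(c_j)}\,\big(1+o(1)\big). \]
   Context: A directed metric graph is a finite directed graph in which each edge $e$ is assigned a positive length (passage time) $t(e)$. A one-way Sperner graph is a strongly connected directed metric graph obtained from a directed tree oriented away from a root vertex $s$ (the source) by adding finitely many edges, each of which goes from some vertex to $s$. For each vertex $v$, $l_v$ is the unique simple chain from $s$ to $v$, and $t(\mu)$ denotes the sum of passage times of the edges of a route $\mu$. Walk: a point starts at $s$ at time $0$ and moves along edges in their direction, traversing each edge $e$ in time $t(e)$; at each vertex it may continue along any outgoing edge (each with nonzero probability); reversing direction inside an edge is forbidden. The endpoint at time $T$ is a point of the metric graph (possibly interior to an edge); $N(T)$ is the number of distinct such points reachable at time $T$ over all choices. *)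

theory Defs
  imports
    Complex_Main
    "HOL-Library.Landau_Symbols"
    "Graph_Theory.Digraph_Component"
    "Graph_Theory.Weighted_Graph"
begin

text \<open>Loops and parallel arcs are allowed.\<close>

locale directed_metric_graph = fin_digraph G for G :: "('a, 'b) pre_digraph" (structure) +
  fixes t :: "'b weight_fun"
  assumes passage_time_pos: "e \<in> arcs G \<Longrightarrow> t e > 0"

text \<open>The library's \<^const>\<open>tree\<close> excludes only directed cycles, hence the following definition.
  Since arc walks are lists of arcs, uniqueness of the walk rules out parallel arcs, loops,
  undirected cycles, and arcs pointing towards the root.\<close>

definition out_tree :: "('a, 'b) pre_digraph \<Rightarrow> 'a \<Rightarrow> bool" where
  "out_tree H s \<longleftrightarrow> wf_digraph H \<and> s \<in> verts H \<and> (\<forall>v \<in> verts H. \<exists>!p. pre_digraph.awalk H s p v)"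

locale one_way_sperner_graph = directed_metric_graph +
  fixes s :: 'a
  assumes strongly_connected: "strongly_connected G"
    and tree_plus_arcs_to_source:
      "\<exists>H. spanning H G \<and> out_tree H s \<and> (\<forall>e \<in> arcs G - arcs H. head G e = s)"

text \<open>The library represents an elementary cycle by an arc list with a chosen starting point.
  Here \<open>c\<^sub>1, \<dots>, c\<^sub>\<beta>\<close> contains exactly one representative of each elementary cycle
  up to rotation, so \<open>\<beta>\<close> is the number of elementary cycles.\<close>

definition enumerates_elementary_cycles ::
  "('a, 'b) pre_digraph \<Rightarrow> nat \<Rightarrow> (nat \<Rightarrow> 'b awalk) \<Rightarrow> bool" where
  "enumerates_elementary_cycles G \<beta> c \<longleftrightarrow>
     (\<forall>j \<in> {1..\<beta>}. pre_digraph.cycle G (c j)) \<and>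
     (\<forall>p. pre_digraph.cycle G p \<longrightarrow> (\<exists>!j. j \<in> {1..\<beta>} \<and> (\<exists>k. p = rotate k (c j))))"

text \<open>Linear independence of an indexed family: repeated values count as a dependence.\<close>

definition rat_independent_family :: "'i set \<Rightarrow> ('i \<Rightarrow> real) \<Rightarrow> bool" where
  "rat_independent_family I f \<longleftrightarrow>
     inj_on f I \<and> module.independent (\<lambda>(q::rat) x. of_rat q * x) (f ` I)"

text \<open>\<open>Interior_Point e x\<close> is the point inside the arc \<open>e\<close> which a walker reaches
  time \<open>x\<close> after leaving the tail of \<open>e\<close>; endpoints of arcs are always given as vertices,
  so every point of the metric graph has exactly one representation.\<close>

datatype ('a, 'b) metric_graph_point = Vertex_Point 'a | Interior_Point 'b real

context directed_metric_graph
begin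

definition possible_endpoints :: "'a \<Rightarrow> real \<Rightarrow> ('a, 'b) metric_graph_point set" where
  "possible_endpoints s T =
     {Vertex_Point v | v p. awalk s p v \<and> awalk_cost t p = T} \<union>
     {Interior_Point e x | e x p. e \<in> arcs G \<and> 0 < x \<and> x < t e \<and>
        awalk s p (tail G e) \<and> awalk_cost t p + x = T}"

definition endpoint_count :: "'a \<Rightarrow> real \<Rightarrow> nat" where
  "endpoint_count s T = card (possible_endpoints s T)"

end

end

theory Submission
  imports Defs "HOL-Analysis.Kronecker_Approximation_Theorem"
begin

text \<open>A walk from \<open>s\<close> to \<open>v\<close> is a sequence of returns to \<open>s\<close>, one along each added arc used, followed by
  the tree path to \<open>v\<close>. So the possible arrival times at \<open>v\<close> are \<open>t(l\<^sub>v) + \<Sum>\<^sub>j n\<^sub>j t(c\<^sub>j)\<close> with \<open>n\<^sub>j \<in> \<nat>\<close>, and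
  distinct \<open>n\<close> give distinct times. With \<open>F X\<close> the number of \<open>n\<close> such that \<open>\<Sum>\<^sub>j n\<^sub>j t(c\<^sub>j) < X\<close>, each
  arc \<open>e\<close> from \<open>u\<close> contributes \<open>F (T - t(l\<^sub>u)) - F (T - t(l\<^sub>u) - t(e))\<close> endpoints, up to a bounded error.

  It remains to show \<open>F X - F (X - a) \<sim> a K X\<^bsup>\<beta>-1\<^esup>\<close> with \<open>K = 1 / ((\<beta>-1)! \<Prod>\<^sub>j t(c\<^sub>j))\<close>. For
  \<open>a = t(c\<^sub>j)\<close> the left side counts the \<open>n\<close> with \<open>n\<^sub>j = 0\<close>, which is a volume estimate in dimension
  \<open>\<beta>-1\<close>. The admissible \<open>a\<close> form a group, which is dense when \<open>\<beta> \<ge> 2\<close> by irrationality of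
  \<open>t(c\<^sub>1) / t(c\<^sub>2)\<close>, and \<open>F\<close> is monotone. When \<open>\<beta> = 1\<close> the graph is a single cycle, and the sum of the
  contributions telescopes to exactly one endpoint.\<close>

section \<open>Counting lattice points in a simplex\<close>

text \<open>Tuples indexed by \<open>J\<close> are encoded as total functions vanishing off
  \<open>J\<close>, so each tuple has exactly one representative and cardinalities count tuples. The
  strict bound makes the count 0 for \<open>X \<le> 0\<close>.\<close>

definition points_below :: "('i \<Rightarrow> real) \<Rightarrow> 'i set \<Rightarrow> real \<Rightarrow> ('i \<Rightarrow> nat) set" where
  "points_below w J X = {n. (\<forall>i. i \<notin> J \<longrightarrow> n i = 0) \<and> (\<Sum>i\<in>J. real (n i) * w i) < X}"

definition count_below :: "('i \<Rightarrow> real) \<Rightarrow> 'i set \<Rightarrow> real \<Rightarrow> real" where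
  "count_below w J X = real (card (points_below w J X))"

lemma finite_points_below:
  assumes "finite J" "\<And>j. j \<in> J \<Longrightarrow> w j > 0"
  shows "finite (points_below w J X)"
proof -
  define N where "N = (\<Sum>j\<in>J. nat \<lceil>X / w j\<rceil>)"
  have "n i \<le> N" if n: "n \<in> points_below w J X" and i: "i \<in> J" for n i
  proof -
    have "real (n i) * w i \<le> (\<Sum>i\<in>J. real (n i) * w i)"
      using assms i by (intro member_le_sum) (auto simp: less_imp_le)
    also have "\<dots> < X" using n by (simp add: points_below_def)
    finally have "real (n i) \<le> X / w i" using assms(2)[OF i] by (simp add: field_simps)
    then have "n i \<le> nat \<lceil>X / w i\<rceil>" by linarith
    also have "\<dots> \<le> N" unfolding N_def using assms(1) i by (intro member_le_sum) auto
    finally show ?thesis .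
  qed
  then have "points_below w J X \<subseteq> {n. \<forall>i. (i \<in> J \<longrightarrow> n i \<in> {..N}) \<and> (i \<notin> J \<longrightarrow> n i = 0)}"
    by (auto simp: points_below_def)
  then show ?thesis using finite_set_of_finite_funs[OF assms(1) finite_atMost] finite_subset by blast
qed

lemma points_below_mono: "X \<le> Y \<Longrightarrow> points_below w J X \<subseteq> points_below w J Y"
  by (auto simp: points_below_def)

lemma count_below_mono:
  assumes "finite J" "\<And>j. j \<in> J \<Longrightarrow> w j > 0" "X \<le> Y"
  shows "count_below w J X \<le> count_below w J Y"
  unfolding count_below_def
  using card_mono[OF finite_points_below[OF assms(1,2)] points_below_mono[OF assms(3)]] by simp

lemma count_below_nonpos:
  assumes "\<And>j. j \<in> J \<Longrightarrow> w j > 0" "X \<le> 0"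
  shows "count_below w J X = 0"
proof -
  have "0 \<le> (\<Sum>i\<in>J. real (n i) * w i)" for n :: "'a \<Rightarrow> nat"
    using assms(1) by (intro sum_nonneg) (auto simp: less_imp_le)
  then have "points_below w J X = {}"
    using assms(2) by (auto simp: points_below_def not_less intro: order_trans)
  then show ?thesis by (simp add: count_below_def)
qed

lemma count_below_empty: "count_below w {} X = (if X > 0 then 1 else 0)"
proof -
  have "points_below w {} X = (if X > 0 then {\<lambda>_. 0} else {})"
    by (auto simp: points_below_def)
  then show ?thesis by (simp add: count_below_def)
qed

text \<open>Tuples with \<open>n j = 0\<close> are tuples over \<open>J\<close>; in the others,
  lowering \<open>n j\<close> by one lowers the bound by \<open>w j\<close>. This drives both
  inductions on the dimension, and it also evaluates increments of length \<open>w j\<close>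
  exactly.\<close>

lemma count_below_insert:
  assumes J: "finite J" "j \<notin> J" and w: "\<And>i. i \<in> insert j J \<Longrightarrow> w i > 0"
  shows "count_below w (insert j J) X = count_below w J X + count_below w (insert j J) (X - w j)"
proof -
  let ?f = "\<lambda>n :: 'a \<Rightarrow> nat. n(j := Suc (n j))"
  let ?A = "points_below w J X" and ?B = "points_below w (insert j J) (X - w j)"
  have upd: "(\<Sum>i\<in>J. real ((n(j := k)) i) * w i) = (\<Sum>i\<in>J. real (n i) * w i)" for n k
    using J by (intro sum.cong) auto
  have "points_below w (insert j J) X = ?A \<union> ?f ` ?B"
  proof (intro equalityI subsetI)
    fix n assume n: "n \<in> points_below w (insert j J) X"
    show "n \<in> ?A \<union> ?f ` ?B"
    proof (cases "n j")
      case 0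
      then have "n i = 0" if "i \<notin> J" for i
        using n that by (cases "i = j") (auto simp: points_below_def)
      with 0 n J show ?thesis by (simp add: points_below_def)
    next
      case (Suc k)
      have "n(j := k) \<in> ?B" using n J Suc upd[of n k] by (auto simp: points_below_def algebra_simps)
      moreover have "n = ?f (n(j := k))" using Suc by auto
      ultimately show ?thesis by blast
    qed
  next
    fix n assume "n \<in> ?A \<union> ?f ` ?B"
    then show "n \<in> points_below w (insert j J) X"
    proof
      assume "n \<in> ?A" then show ?thesis using J by (auto simp: points_below_def)
    next
      assume "n \<in> ?f ` ?B"
      then obtain m where m: "m \<in> ?B" "n = ?f m" by blast
      then show ?thesis using J upd[of m "Suc (m j)"] by (auto simp: points_below_def algebra_simps)
    qed
  qed
  moreover have "?A \<inter> ?f ` ?B = {}" using J by (auto simp: points_below_def)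
  moreover have "inj_on ?f ?B"
    by (rule inj_onI) (metis fun_upd_same fun_upd_triv fun_upd_upd nat.inject)
  moreover have "finite ?A" "finite ?B" using J w by (auto intro!: finite_points_below)
  ultimately show ?thesis by (simp add: count_below_def card_Un_disjoint card_image)
qed

text \<open>Bernoulli's inequality for \<open>h / y\<close>, scaled by \<open>y ^ Suc k\<close>. The
  lower count bound uses it with \<open>h = - w j\<close>, the upper one with
  \<open>h = w j\<close>.\<close>

lemma Bernoulli_step:
  fixes y h :: real
  assumes "y > 0" "y + h \<ge> 0"
  shows "y ^ Suc k + real (Suc k) * h * y ^ k \<le> (y + h) ^ Suc k"
proof -
  have "1 + real (Suc k) * (h / y) \<le> (1 + h / y) ^ Suc k"
    using assms by (intro Bernoulli_inequality) (simp add: field_simps)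
  then have "y ^ Suc k * (1 + real (Suc k) * (h / y)) \<le> y ^ Suc k * (1 + h / y) ^ Suc k"
    using assms by (intro mult_left_mono) auto
  moreover have "y ^ Suc k * (1 + real (Suc k) * (h / y)) = y ^ Suc k + real (Suc k) * h * y ^ k"
    using assms by (simp add: field_simps)
  moreover have "y ^ Suc k * (1 + h / y) ^ Suc k = (y + h) ^ Suc k"
    using assms by (simp add: distrib_left flip: power_mult_distrib del: power_Suc)
  ultimately show ?thesis by simp
qed

text \<open>Geometrically, the unit boxes at the counted points cover the simplex, whose volume is
  the left side. The proof avoids volumes: it inducts on the dimension and sums the recursion over
  slices.\<close>

lemma count_below_lower:
  assumes "finite J" "\<And>j. j \<in> J \<Longrightarrow> w j > 0" "X > 0"
  shows "X ^ card J / (fact (card J) * (\<Prod>j\<in>J. w j)) \<le> count_below w J X"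
  using assms
proof (induction J arbitrary: X rule: finite_induct)
  case empty then show ?case by (simp add: count_below_empty)
next
  case (insert j J)
  let ?k = "card J" and ?c = "w j" and ?P = "\<Prod>j\<in>J. w j"
  have c: "?c > 0" and P: "?P > 0" using insert.prems by (auto intro!: prod_pos)
  have step: "X ^ ?k / (fact ?k * ?P) + count_below w (insert j J) (X - ?c) \<le> count_below w (insert j J) X"
    if "X > 0" for X
    using insert.IH[OF _ that] insert count_below_insert[of J j w X] by auto
  \<comment> \<open>Puts the lower-dimensional bound over the denominator of the next dimension, so
    that only a comparison of numerators remains.\<close>
  have conv: "X ^ ?k / (fact ?k * ?P) = real (Suc ?k) * ?c * X ^ ?k / (fact (Suc ?k) * (?c * ?P))" for X
    using c P by (simp add: divide_simps)
  \<comment> \<open>Inner induction on the number of steps of length \<open>w j\<close> that bring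
    \<open>X\<close> down to 0 or below.\<close>
  have "X ^ Suc ?k / (fact (Suc ?k) * (?c * ?P)) \<le> count_below w (insert j J) X"
    if "X > 0" "X \<le> real m * ?c" for X m
    using that
  proof (induction m arbitrary: X)
    case (Suc m)
    show ?case
    proof (cases "X \<le> ?c")
      \<comment> \<open>In the last step the slice \<open>n j = 0\<close> alone suffices, because
        \<open>X \<le> Suc ?k * w j\<close>; the rest of the count only has to be
        nonnegative.\<close>
      case True
      have "X ^ Suc ?k \<le> real (Suc ?k) * ?c * X ^ ?k"
      proof -
        have "1 * ?c \<le> real (Suc ?k) * ?c" using c by (intro mult_right_mono) auto
        then have "X \<le> real (Suc ?k) * ?c" using True by linarith
        then show ?thesis using Suc.prems by (simp only: power_Suc mult_right_mono zero_le_power less_imp_le)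
      qed
      then have "X ^ Suc ?k / (fact (Suc ?k) * (?c * ?P)) \<le> X ^ ?k / (fact ?k * ?P)"
        unfolding conv using c P by (intro divide_right_mono) auto
      moreover have "count_below w (insert j J) (X - ?c) \<ge> 0" by (simp add: count_below_def)
      ultimately show ?thesis using step[of X] Suc.prems by linarith
    next
      case False
      have "X ^ Suc ?k \<le> real (Suc ?k) * ?c * X ^ ?k + (X - ?c) ^ Suc ?k"
        using Bernoulli_step[of X "- ?c" ?k] False Suc.prems by simp
      then have "X ^ Suc ?k / (fact (Suc ?k) * (?c * ?P)) \<le>
        (real (Suc ?k) * ?c * X ^ ?k + (X - ?c) ^ Suc ?k) / (fact (Suc ?k) * (?c * ?P))"
        using c P by (intro divide_right_mono) auto
      also have "\<dots> = X ^ ?k / (fact ?k * ?P) + (X - ?c) ^ Suc ?k / (fact (Suc ?k) * (?c * ?P))"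
        unfolding conv by (simp add: add_divide_distrib)
      also have "\<dots> \<le> X ^ ?k / (fact ?k * ?P) + count_below w (insert j J) (X - ?c)"
        using Suc.IH[of "X - ?c"] Suc.prems False by (simp add: algebra_simps)
      also have "\<dots> \<le> count_below w (insert j J) X" by (rule step) (use Suc.prems in auto)
      finally show ?thesis .
    qed
  qed auto
  moreover obtain m where "X \<le> real m * ?c"
    using reals_Archimedean3[OF c] by (metis less_imp_le)
  ultimately show ?case using insert by simp
qed

text \<open>The unit boxes at the counted points stay inside the simplex with bound \<open>X\<close>
  plus the sum of the weights, which explains the enlarged base. The double induction is that of the
  lower bound.\<close>

lemma count_below_upper:
  assumes "finite J" "\<And>j. j \<in> J \<Longrightarrow> w j > 0" "X > 0"
  shows "count_below w J X \<le> (X + (\<Sum>j\<in>J. w j)) ^ card J / (fact (card J) * (\<Prod>j\<in>J. w j))"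
  using assms
proof (induction J arbitrary: X rule: finite_induct)
  case empty then show ?case by (simp add: count_below_empty)
next
  case (insert j J)
  let ?k = "card J" and ?c = "w j" and ?P = "\<Prod>j\<in>J. w j" and ?S = "\<Sum>j\<in>J. w j"
  have c: "?c > 0" and P: "?P > 0" and S: "?S \<ge> 0"
    using insert.prems by (auto intro!: prod_pos sum_nonneg simp: less_imp_le)
  have step: "count_below w (insert j J) X \<le>
      (X + ?S) ^ ?k / (fact ?k * ?P) + count_below w (insert j J) (X - ?c)" if "X > 0" for X
    using insert.IH[OF _ that] insert count_below_insert[of J j w X] by auto
  have conv: "y ^ ?k / (fact ?k * ?P) = real (Suc ?k) * ?c * y ^ ?k / (fact (Suc ?k) * (?c * ?P))" for y
    using c P by (simp add: divide_simps)
  have "count_below w (insert j J) X \<le> (X + ?S + ?c) ^ Suc ?k / (fact (Suc ?k) * (?c * ?P))"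
    if "X > 0" "X \<le> real m * ?c" for X m
    using that
  proof (induction m arbitrary: X)
    case (Suc m)
    let ?D = "fact (Suc ?k) * (?c * ?P)"
    \<comment> \<open>For \<open>X - w j\<close> the enlarged base is
      \<open>X - ?c + ?S + ?c = X + ?S\<close>, the same base as in the slice bound, so the two
      terms combine by Bernoulli.\<close>
    have tail: "count_below w (insert j J) (X - ?c) \<le> (X + ?S) ^ Suc ?k / ?D"
    proof (cases "X \<le> ?c")
      case True
      then have "count_below w (insert j J) (X - ?c) = 0"
        using insert.prems by (intro count_below_nonpos) auto
      moreover have "0 \<le> (X + ?S) ^ Suc ?k / ?D"
        using c P S Suc.prems by (intro divide_nonneg_nonneg zero_le_power) auto
      ultimately show ?thesis by linarith
    next
      case False
      then show ?thesis using Suc.IH[of "X - ?c"] Suc.prems by (simp add: algebra_simps)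
    qed
    have "count_below w (insert j J) X \<le> (X + ?S) ^ ?k / (fact ?k * ?P) + (X + ?S) ^ Suc ?k / ?D"
      using step[of X] tail Suc.prems by linarith
    also have "\<dots> = ((X + ?S) ^ Suc ?k + real (Suc ?k) * ?c * (X + ?S) ^ ?k) / ?D"
      unfolding conv by (simp add: add_divide_distrib)
    also have "\<dots> \<le> (X + ?S + ?c) ^ Suc ?k / ?D"
      using Bernoulli_step[of "X + ?S" ?c ?k] c P S Suc.prems by (intro divide_right_mono) (auto intro: add_pos_nonneg)
    finally show ?case .
  qed auto
  moreover obtain m where "X \<le> real m * ?c"
    using reals_Archimedean3[OF c] by (metis less_imp_le)
  ultimately have "count_below w (insert j J) X \<le> (X + ?S + ?c) ^ Suc ?k / (fact (Suc ?k) * (?c * ?P))"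
    using insert.prems by blast
  then show ?case using insert by (simp add: add_ac)
qed

text \<open>Lets a constant shift of the argument be ignored at the leading order.\<close>

lemma shift_ratio_power_tendsto: "((\<lambda>X :: real. ((X + a) / X) ^ k) \<longlongrightarrow> 1) at_top"
proof -
  have "((\<lambda>X :: real. a / X) \<longlongrightarrow> 0) at_top"
    by (intro real_tendsto_divide_at_top[OF tendsto_const] filterlim_ident)
  then have "((\<lambda>X :: real. (1 + a / X) ^ k) \<longlongrightarrow> (1 + 0) ^ k) at_top"
    by (intro tendsto_intros)
  moreover have "\<forall>\<^sub>F X in at_top. (1 + a / X) ^ k = ((X + a) / X) ^ k"
    using eventually_gt_at_top[of 0] by eventually_elim (simp add: add_divide_distrib)
  ultimately show ?thesis using tendsto_cong by fastforce
qed

lemma count_below_asymp: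
  assumes "finite J" "\<And>j. j \<in> J \<Longrightarrow> w j > 0"
  shows "((\<lambda>X. count_below w J X / X ^ card J) \<longlongrightarrow> 1 / (fact (card J) * (\<Prod>j\<in>J. w j))) at_top"
proof (rule tendsto_sandwich)
  let ?D = "fact (card J) * (\<Prod>j\<in>J. w j)" and ?S = "\<Sum>j\<in>J. w j"
  show "\<forall>\<^sub>F X in at_top. 1 / ?D \<le> count_below w J X / X ^ card J"
    using eventually_gt_at_top[of 0]
    by eventually_elim (use count_below_lower[of J w] assms in \<open>simp add: field_simps\<close>)
  show "\<forall>\<^sub>F X in at_top. count_below w J X / X ^ card J \<le> ((X + ?S) / X) ^ card J * (1 / ?D)"
    using eventually_gt_at_top[of 0]
  proof eventually_elim
    case (elim X)
    have "count_below w J X / X ^ card J \<le> (X + ?S) ^ card J / ?D / X ^ card J"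
      using elim assms by (intro divide_right_mono count_below_upper) auto
    then show ?case by (simp add: power_divide mult.commute)
  qed
  show "((\<lambda>X. ((X + ?S) / X) ^ card J * (1 / ?D)) \<longlongrightarrow> 1 / ?D) at_top"
    using tendsto_mult_right[OF shift_ratio_power_tendsto[of ?S "card J"], of "1 / ?D"] by simp
qed auto

section \<open>Increments of the counting function\<close>

text \<open>Says that \<open>F\<close> grows like an antiderivative of \<open>K * X ^ m\<close>,
  tested on the step \<open>a\<close>. Stating it as a limit admits zero and negative
  \<open>a\<close>, so that the admissible steps can form a group.\<close>

definition linear_increment :: "(real \<Rightarrow> real) \<Rightarrow> nat \<Rightarrow> real \<Rightarrow> real \<Rightarrow> bool" where
  "linear_increment F m K a \<longleftrightarrow> ((\<lambda>X. (F X - F (X - a)) / X ^ m) \<longlongrightarrow> a * K) at_top"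

text \<open>The increment over \<open>a + b\<close> telescopes through \<open>X - a\<close>; the
  power ratio converts the normalisation at \<open>X - a\<close> into the one at
  \<open>X\<close>.\<close>

lemma linear_increment_add:
  assumes "linear_increment F m K a" "linear_increment F m K b"
  shows "linear_increment F m K (a + b)"
proof -
  have lim: "filterlim (\<lambda>X :: real. X - a) at_top at_top"
    using filterlim_tendsto_add_at_top[OF tendsto_const[of "-a"] filterlim_ident] by simp
  have "((\<lambda>X. (F (X - a) - F (X - a - b)) / (X - a) ^ m) \<longlongrightarrow> b * K) at_top"
    using filterlim_compose[OF assms(2)[unfolded linear_increment_def] lim] .
  from tendsto_add[OF assms(1)[unfolded linear_increment_def]
      tendsto_mult[OF this shift_ratio_power_tendsto[of "-a" m]]]
  have "((\<lambda>X. (F X - F (X - a)) / X ^ m +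
      (F (X - a) - F (X - a - b)) / (X - a) ^ m * ((X + - a) / X) ^ m) \<longlongrightarrow> a * K + b * K * 1) at_top" .
  moreover have "\<forall>\<^sub>F X in at_top. (F X - F (X - a)) / X ^ m +
      (F (X - a) - F (X - a - b)) / (X - a) ^ m * ((X + - a) / X) ^ m = (F X - F (X - (a + b))) / X ^ m"
    using eventually_gt_at_top[of "max 0 a"]
  proof eventually_elim
    case (elim X)
    then have "((X - a) ^ m) \<noteq> 0" "X ^ m \<noteq> 0" by auto
    then show ?case by (simp add: power_divide diff_diff_eq flip: add_divide_distrib)
  qed
  ultimately show ?thesis
    unfolding linear_increment_def using tendsto_cong by (fastforce simp: algebra_simps)
qed

lemma linear_increment_uminus:
  assumes "linear_increment F m K a"
  shows "linear_increment F m K (- a)"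
proof -
  have lim: "filterlim (\<lambda>X :: real. X + a) at_top at_top"
    using filterlim_tendsto_add_at_top[OF tendsto_const[of "a"] filterlim_ident] by (simp add: add.commute)
  have "((\<lambda>X. (F (X + a) - F (X + a - a)) / (X + a) ^ m) \<longlongrightarrow> a * K) at_top"
    using filterlim_compose[OF assms(1)[unfolded linear_increment_def] lim] .
  from tendsto_minus[OF tendsto_mult[OF this shift_ratio_power_tendsto[of "a" m]]]
  have "((\<lambda>X. - ((F (X + a) - F (X + a - a)) / (X + a) ^ m * ((X + a) / X) ^ m)) \<longlongrightarrow> - (a * K * 1)) at_top" .
  moreover have "\<forall>\<^sub>F X in at_top. - ((F (X + a) - F (X + a - a)) / (X + a) ^ m * ((X + a) / X) ^ m)
      = (F X - F (X - - a)) / X ^ m"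
    using eventually_gt_at_top[of "max 0 (-a)"]
  proof eventually_elim
    case (elim X)
    then have "((X + a) ^ m) \<noteq> 0" "X ^ m \<noteq> 0" by auto
    then show ?case by (simp add: power_divide) (metis minus_diff_eq minus_divide_left)
  qed
  ultimately show ?thesis
    unfolding linear_increment_def using tendsto_cong by fastforce
qed

lemma linear_increment_of_int_mult:
  assumes "linear_increment F m K a"
  shows "linear_increment F m K (of_int k * a)"
proof -
  have nat: "linear_increment F m K (real n * a)" for n
  proof (induction n)
    case 0 show ?case by (simp add: linear_increment_def)
  next
    case (Suc n) with linear_increment_add[OF assms Suc] show ?case by (simp add: algebra_simps)
  qed
  show ?thesis
  proof (cases k rule: int_cases2)
    case (nonneg n) with nat show ?thesis by simp
  next
    case (nonpos n) with linear_increment_uminus[OF nat[of n]] show ?thesis by simp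
  qed
qed

text \<open>Integer combinations of \<open>a\<close> and \<open>b\<close> are admissible, and they
  are dense because \<open>a / b\<close> is irrational. Monotonicity of \<open>F\<close> then traps
  the increment for any \<open>x\<close> between those for admissible steps just below and just
  above.\<close>

lemma linear_increment_dense:
  assumes F: "mono F" and K: "K > 0"
    and a: "linear_increment F m K a" and b: "linear_increment F m K b"
    and b0: "b > 0" and irr: "a / b \<notin> \<rat>"
  shows "linear_increment F m K x"
proof -
  have dense: "\<exists>y. linear_increment F m K y \<and> \<bar>y - z\<bar> < e" if "e > 0" for z e
  proof -
    \<comment> \<open>Kronecker's theorem in dimension one: \<open>k * (a / b)\<close> modulo 1
      comes close to \<open>z / b\<close>. Multiplying by \<open>b\<close> gives the combination
      \<open>?y\<close>.\<close>
    obtain h k where hk: "\<bar>of_int k * (a / b) - of_int h - z / b\<bar> < e / b"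
      using sequence_of_fractional_parts_is_dense[OF irr, of "e / b" "z / b"] \<open>e > 0\<close> b0
      by (metis divide_pos_pos)
    let ?y = "of_int k * a + of_int (- h) * b"
    have "of_int k * (a / b) - of_int h - z / b = (?y - z) / b"
      using b0 by (simp add: field_simps)
    with hk have "\<bar>?y - z\<bar> < e" using b0 by (simp add: divide_simps)
    moreover have "linear_increment F m K ?y"
      by (intro linear_increment_add linear_increment_of_int_mult a b)
    ultimately show ?thesis by blast
  qed
  have le: "(F X - F (X - y)) / X ^ m \<le> (F X - F (X - z)) / X ^ m" if "y \<le> z" "X > 0" for X y z
    using monoD[OF F, of "X - z" "X - y"] that by (intro divide_right_mono) auto
  show ?thesis unfolding linear_increment_def
  proof (rule order_tendstoI)
    fix l assume "l < x * K"
    \<comment> \<open>Half the gap between \<open>l / K\<close> and \<open>x\<close>: the ball of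
      radius \<open>e\<close> around \<open>x - e\<close> is exactly the interval from
      \<open>l / K\<close> to \<open>x\<close>.\<close>
    define e where "e = (x * K - l) / (2 * K)"
    have e: "e > 0" and l: "l / K = x - 2 * e"
      using \<open>l < x * K\<close> K by (auto simp: e_def field_simps)
    obtain y where y: "linear_increment F m K y" "\<bar>y - (x - e)\<bar> < e"
      using dense[OF e] by blast
    then have "y \<le> x" "y > l / K" unfolding l by (auto simp: abs_less_iff)
    then have "l < y * K" using K by (simp add: field_simps)
    then have "\<forall>\<^sub>F X in at_top. l < (F X - F (X - y)) / X ^ m"
      using y(1) unfolding linear_increment_def by (rule order_tendstoD(1)[rotated])
    then show "\<forall>\<^sub>F X in at_top. l < (F X - F (X - x)) / X ^ m"
      using eventually_gt_at_top[of 0]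
      by eventually_elim (use le[OF \<open>y \<le> x\<close>] in \<open>auto intro: less_le_trans\<close>)
  next
    fix l assume "l > x * K"
    define e where "e = (l - x * K) / (2 * K)"
    have e: "e > 0" and l: "l / K = x + 2 * e"
      using \<open>l > x * K\<close> K by (auto simp: e_def field_simps)
    obtain y where y: "linear_increment F m K y" "\<bar>y - (x + e)\<bar> < e"
      using dense[OF e] by blast
    then have "x \<le> y" "y < l / K" unfolding l by (auto simp: abs_less_iff)
    then have "y * K < l" using K by (simp add: field_simps)
    then have "\<forall>\<^sub>F X in at_top. (F X - F (X - y)) / X ^ m < l"
      using y(1) unfolding linear_increment_def by (rule order_tendstoD(2)[rotated])
    then show "\<forall>\<^sub>F X in at_top. (F X - F (X - x)) / X ^ m < l"
      using eventually_gt_at_top[of 0]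
      by eventually_elim (use le[OF \<open>x \<le> y\<close>] in \<open>auto intro: le_less_trans\<close>)
  qed
qed

text \<open>For the step \<open>w j\<close> the increment is the count without coordinate
  \<open>j\<close>, of one dimension less; dropping \<open>w j\<close> from the product supplies the
  factor \<open>w j\<close> of the limit. Two steps with irrational ratio then give all
  steps.\<close>

lemma count_below_linear_increment:
  assumes J: "finite J" and w: "\<And>j. j \<in> J \<Longrightarrow> w j > 0"
    and ij: "i \<in> J" "j \<in> J" "w i / w j \<notin> \<rat>"
  shows "linear_increment (count_below w J) (card J - 1) (1 / (fact (card J - 1) * (\<Prod>j\<in>J. w j))) x"
proof -
  let ?K = "1 / (fact (card J - 1) * (\<Prod>j\<in>J. w j))"
  have "linear_increment (count_below w J) (card J - 1) ?K (w j)" if j: "j \<in> J" for j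
  proof -
    have "count_below w J X - count_below w J (X - w j) = count_below w (J - {j}) X" for X
      using count_below_insert[of "J - {j}" j w X] J w j by (simp add: insert_absorb)
    moreover have "((\<lambda>X. count_below w (J - {j}) X / X ^ card (J - {j})) \<longlongrightarrow>
        1 / (fact (card (J - {j})) * (\<Prod>j\<in>J - {j}. w j))) at_top"
      using J w by (intro count_below_asymp) auto
    moreover have "1 / (fact (card (J - {j})) * (\<Prod>j\<in>J - {j}. w j)) = w j * ?K"
      using J j w[OF j] by (simp add: prod.remove[of J j] card_Diff_singleton)
    ultimately show ?thesis using J j by (simp add: linear_increment_def card_Diff_singleton)
  qed
  moreover have "mono (count_below w J)"
    by (intro monoI count_below_mono J w)
  moreover have "?K > 0" using w by (simp add: prod_pos)
  ultimately show ?thesis using linear_increment_dense ij w by blast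
qed

section \<open>Rationally independent families\<close>

lemma vector_space_of_rat_mult: "vector_space (\<lambda>(q::rat) x :: real. of_rat q * x)"
  by unfold_locales (simp_all add: algebra_simps of_rat_add of_rat_mult)

text \<open>Independence is a property of the set of values; injectivity of the family turns
  coefficients on indices into coefficients on values.\<close>

lemma rat_independent_familyD:
  assumes ind: "rat_independent_family I f" and S: "finite S" "S \<subseteq> I"
    and eq: "(\<Sum>i\<in>S. of_rat (q i) * f i) = (0::real)" and i: "i \<in> S"
  shows "q i = 0"
proof -
  interpret vector_space "\<lambda>(q::rat) x :: real. of_rat q * x"
    by (rule vector_space_of_rat_mult)
  have inj: "inj_on f S" and indep: "independent (f ` I)"
    using ind S by (auto simp: rat_independent_family_def intro: inj_on_subset)
  have "(\<Sum>x\<in>f ` S. of_rat (q (inv_into S f x)) * x) = (\<Sum>i\<in>S. of_rat (q i) * f i)"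
    using inj by (simp add: sum.reindex)
  then have "q (inv_into S f (f i)) = 0"
    using independentD[OF indep, of "f ` S" "\<lambda>x. q (inv_into S f x)" "f i"] S eq i by auto
  then show ?thesis using inj i by simp
qed

text \<open>Serves to carry independence from the cycles to the back arcs by reindexing.\<close>

lemma rat_independent_family_comp:
  assumes "rat_independent_family I f" "inj_on g K" "g ` K \<subseteq> I" "\<And>k. k \<in> K \<Longrightarrow> h k = f (g k)"
  shows "rat_independent_family K h"
proof -
  interpret vector_space "\<lambda>(q::rat) x :: real. of_rat q * x"
    by (rule vector_space_of_rat_mult)
  have "inj_on f (g ` K)" "independent (f ` I)"
    using assms(1,3) by (auto simp: rat_independent_family_def intro: inj_on_subset)
  moreover have h: "h ` K = f ` g ` K" using assms(4) by (auto simp: image_image)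
  ultimately have "independent (h ` K)" using assms(3) by (metis image_mono independent_mono)
  moreover have "inj_on h K"
    using comp_inj_on[OF assms(2) \<open>inj_on f (g ` K)\<close>] assms(4) by (simp add: inj_on_def)
  ultimately show ?thesis by (simp add: rat_independent_family_def)
qed

lemma rat_independent_family_inj_combinations:
  assumes "rat_independent_family J w" "finite J"
  shows "inj_on (\<lambda>n. \<Sum>i\<in>J. real (n i) * w i) {n. \<forall>i. i \<notin> J \<longrightarrow> n i = 0}"
proof (intro inj_onI ext)
  fix n m :: "'a \<Rightarrow> nat" and i
  assume nm: "n \<in> {n. \<forall>i. i \<notin> J \<longrightarrow> n i = 0}" "m \<in> {n. \<forall>i. i \<notin> J \<longrightarrow> n i = 0}"
    and eq: "(\<Sum>i\<in>J. real (n i) * w i) = (\<Sum>i\<in>J. real (m i) * w i)"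
  have "(\<Sum>i\<in>J. of_rat (of_nat (n i) - of_nat (m i)) * w i) = 0"
    using eq by (simp add: of_rat_diff left_diff_distrib sum_subtractf)
  then have "i \<in> J \<Longrightarrow> (of_nat (n i) - of_nat (m i) :: rat) = 0"
    by (rule rat_independent_familyD[OF assms order_refl])
  then show "n i = m i" using nm by (cases "i \<in> J") auto
qed

lemma rat_independent_family_irrational_ratio:
  assumes "rat_independent_family J w" "i \<in> J" "j \<in> J" "i \<noteq> j"
  shows "w i / w j \<notin> \<rat>"
proof
  assume "w i / w j \<in> \<rat>"
  then obtain r where r: "w i / w j = of_rat r" by (auto simp: Rats_def)
  \<comment> \<open>Since division by zero yields 0, a zero \<open>w j\<close> would also give a
    rational ratio; it is excluded as a relation with the single coefficient 1.\<close>
  have "w j \<noteq> 0"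
    using rat_independent_familyD[OF assms(1), of "{j}" "\<lambda>_. 1" j] assms by auto
  define q where "q k = (if k = i then 1 else - r)" for k
  have "(\<Sum>k\<in>{i, j}. of_rat (q k) * w k) = 0"
    using assms(4) r \<open>w j \<noteq> 0\<close> by (simp add: q_def field_simps of_rat_minus)
  then have "q i = 0"
    by (rule rat_independent_familyD[OF assms(1), rotated 2]) (use assms in auto)
  then show False by (simp add: q_def)
qed

section \<open>Walks in a one-way Sperner graph\<close>

text \<open>Fixes one of the trees whose existence \<open>one_way_sperner_graph\<close> asserts, so
  that depths can be defined from it.\<close>

locale sperner_tree = directed_metric_graph G t for G :: "('a, 'b) pre_digraph" (structure) and t +
  fixes s :: 'a and H :: "('a, 'b) pre_digraph"
  assumes spanning: "spanning H G"
    and out_tree: "out_tree H s"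
    and head_back: "e \<in> arcs G - arcs H \<Longrightarrow> head G e = s"
begin

definition back_arcs :: "'b set" where
  "back_arcs = arcs G - arcs H"

definition tree_walk :: "'a \<Rightarrow> 'b awalk" where
  "tree_walk v = (THE p. pre_digraph.awalk H s p v)"

definition depth :: "'a \<Rightarrow> real" where
  "depth v = awalk_cost t (tree_walk v)"

text \<open>For a tree arc this is the depth of its head; for a back arc it is the length of the
  cycle that the arc closes.\<close>

definition arrival :: "'b \<Rightarrow> real" where
  "arrival e = depth (tail G e) + t e"

text \<open>The additive monoid generated by the cycle lengths. It turns out to consist exactly of
  the durations of closed walks at \<open>s\<close>.\<close>

definition return_times :: "real set" where
  "return_times = {\<Sum>b\<in>back_arcs. real (n b) * arrival b | n. \<forall>b. b \<notin> back_arcs \<longrightarrow> n b = 0}"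

lemma finite_back_arcs [simp]: "finite back_arcs"
  by (simp add: back_arcs_def)

lemma subgraph: "subgraph H G" and verts_tree: "verts H = verts G" and arcs_tree: "arcs H \<subseteq> arcs G"
  using spanning by (auto simp: spanning_def subgraph_def)

lemma source_in_verts: "s \<in> verts G"
  using out_tree by (simp add: out_tree_def verts_tree)

lemma awalk_tree_iff: "pre_digraph.awalk H u p v \<longleftrightarrow> awalk u p v \<and> set p \<subseteq> arcs H"
proof -
  have "compatible G H" using subgraph by (simp add: subgraph_def)
  then show ?thesis
    using arcs_tree verts_tree by (auto simp: pre_digraph.awalk_def compatible_cas)
qed

lemma tree_walk_unique:
  assumes "awalk s p v" "set p \<subseteq> arcs H"
  shows "tree_walk v = p"
proof -
  have "v \<in> verts H" using assms verts_tree by (auto dest: awalk_last_in_verts)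
  then have "\<exists>!p. pre_digraph.awalk H s p v" using out_tree by (simp add: out_tree_def)
  then show ?thesis
    unfolding tree_walk_def using assms by (auto simp: awalk_tree_iff intro: the1_equality)
qed

lemma
  assumes "v \<in> verts G"
  shows awalk_tree_walk: "awalk s (tree_walk v) v"
    and set_tree_walk: "set (tree_walk v) \<subseteq> arcs H"
proof -
  have "\<exists>!p. pre_digraph.awalk H s p v"
    using out_tree assms verts_tree by (simp add: out_tree_def)
  then have "pre_digraph.awalk H s (tree_walk v) v"
    unfolding tree_walk_def by (rule theI')
  then show "awalk s (tree_walk v) v" "set (tree_walk v) \<subseteq> arcs H"
    by (auto simp: awalk_tree_iff)
qed

lemma tree_walk_source: "tree_walk s = []"
  using source_in_verts by (intro tree_walk_unique) (auto simp: awalk_Nil_iff)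

lemma awalk_snoc: "awalk u (p @ [e]) v \<longleftrightarrow> awalk u p (tail G e) \<and> e \<in> arcs G \<and> head G e = v"
  by (auto simp: awalk_simps)

lemma tree_walk_head:
  assumes "e \<in> arcs H"
  shows "tree_walk (head G e) = tree_walk (tail G e) @ [e]"
proof -
  have "e \<in> arcs G" using assms arcs_tree by blast
  then have "tail G e \<in> verts G" by simp
  then show ?thesis
    using assms \<open>e \<in> arcs G\<close> awalk_tree_walk[of "tail G e"] set_tree_walk[of "tail G e"]
    by (intro tree_walk_unique) (simp_all add: awalk_snoc del: awalk_append_iff)
qed

text \<open>The inverse sends a vertex to the last arc of its tree walk; only the tree walk of
  \<open>s\<close> is empty.\<close>

lemma bij_betw_head_tree: "bij_betw (head G) (arcs H) (verts G - {s})"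
  unfolding bij_betw_def
proof
  show "inj_on (head G) (arcs H)"
    by (rule inj_onI) (metis tree_walk_head last_snoc)
  show "head G ` arcs H = verts G - {s}"
  proof (intro equalityI subsetI)
    fix v assume "v \<in> head G ` arcs H"
    then obtain e where e: "e \<in> arcs H" "v = head G e" by blast
    then have "v \<noteq> s" using tree_walk_head[of e] tree_walk_source by auto
    then show "v \<in> verts G - {s}" using e arcs_tree by auto
  next
    fix v assume v: "v \<in> verts G - {s}"
    show "v \<in> head G ` arcs H"
    proof (cases "tree_walk v" rule: rev_cases)
      case Nil
      then show ?thesis using awalk_tree_walk[of v] v by (auto simp: awalk_Nil_iff)
    next
      case (snoc p e)
      then show ?thesis using awalk_tree_walk[of v] set_tree_walk[of v] v
        by (auto simp: awalk_snoc simp del: awalk_append_iff)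
    qed
  qed
qed

section \<open>Depths, return times and the durations of walks\<close>

lemma depth_source: "depth s = 0"
  by (simp add: depth_def tree_walk_source)

lemma depth_head: "e \<in> arcs H \<Longrightarrow> depth (head G e) = arrival e"
  by (simp add: depth_def arrival_def tree_walk_head)

lemma arrival_pos:
  assumes "e \<in> arcs G"
  shows "arrival e > 0"
proof -
  have "sum_list (map t p) \<ge> 0" if "set p \<subseteq> arcs G" for p
    using that passage_time_pos by (intro sum_list_nonneg) (auto simp: less_imp_le subset_iff)
  then have "depth (tail G e) \<ge> 0"
    using set_tree_walk[of "tail G e"] arcs_tree assms by (simp add: depth_def awalk_cost_def)
  then show ?thesis using passage_time_pos[OF assms] by (simp add: arrival_def)
qed

lemma return_times_add_arrival:
  assumes "x \<in> return_times" "b \<in> back_arcs"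
  shows "x + arrival b \<in> return_times"
proof -
  obtain n where n: "x = (\<Sum>b\<in>back_arcs. real (n b) * arrival b)" "\<forall>b. b \<notin> back_arcs \<longrightarrow> n b = 0"
    using assms(1) by (auto simp: return_times_def)
  have "(\<Sum>c\<in>back_arcs. real ((n(b := Suc (n b))) c) * arrival c)
      = (\<Sum>c\<in>back_arcs. real (n c) * arrival c + (if c = b then arrival c else 0))"
    by (intro sum.cong) (auto simp: algebra_simps)
  also have "\<dots> = x + arrival b" using assms(2) n by (simp add: sum.distrib)
  finally show ?thesis using n assms(2) unfolding return_times_def
    by (intro CollectI exI[of _ "n(b := Suc (n b))"]) auto
qed

text \<open>Follow the walk arc by arc. A tree arc raises cost and depth equally; a back arc resets
  the depth to 0, so the difference grows by \<open>arrival e\<close>.\<close>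

lemma awalk_cost_diff_depth:
  assumes "awalk s p v"
  shows "awalk_cost t p - depth v \<in> return_times"
  using assms
proof (induction p arbitrary: v rule: rev_induct)
  case Nil
  then have "v = s" by (simp add: awalk_Nil_iff)
  moreover have "0 \<in> return_times"
    unfolding return_times_def by (intro CollectI exI[of _ "\<lambda>_. 0"]) simp
  ultimately show ?case by (simp add: depth_source)
next
  case (snoc e p)
  then have e: "awalk s p (tail G e)" "e \<in> arcs G" "head G e = v"
    unfolding awalk_snoc by auto
  note IH = snoc.IH[OF e(1)]
  show ?case
  proof (cases "e \<in> arcs H")
    case True then show ?thesis using IH e depth_head[OF True] by (simp add: arrival_def)
  next
    case False
    then have "v = s" "e \<in> back_arcs" using e head_back by (auto simp: back_arcs_def)
    then show ?thesis using return_times_add_arrival[OF IH, of e]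
      by (simp add: arrival_def depth_source)
  qed
qed

definition return_cycle :: "'b \<Rightarrow> 'b awalk" where
  "return_cycle b = tree_walk (tail G b) @ [b]"

lemma awalk_return_cycle: "b \<in> back_arcs \<Longrightarrow> awalk s (return_cycle b) s"
  unfolding return_cycle_def awalk_snoc by (auto simp: back_arcs_def head_back awalk_tree_walk)

lemma cost_return_cycle: "awalk_cost t (return_cycle b) = arrival b"
  by (simp add: return_cycle_def arrival_def depth_def)

text \<open>Closed walks at \<open>s\<close> can be concatenated, so their costs are closed under
  addition; they contain \<open>arrival b\<close> for every back arc \<open>b\<close>.\<close>

lemma return_time_awalk:
  assumes "x \<in> return_times"
  shows "\<exists>p. awalk s p s \<and> awalk_cost t p = x"
proof -
  let ?C = "{awalk_cost t p | p. awalk s p s}"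
  have zero: "0 \<in> ?C" using source_in_verts by (auto simp: awalk_Nil_iff intro!: exI[of _ "[]"])
  have add: "x + y \<in> ?C" if "x \<in> ?C" "y \<in> ?C" for x y
    using that by clarsimp (metis awalk_appendI awalk_cost_append)
  have mult: "real k * x \<in> ?C" if "x \<in> ?C" for k x
  proof (induction k)
    case 0 then show ?case using zero by simp
  next
    case (Suc k) then show ?case using add[OF that Suc] by (simp only: of_nat_Suc distrib_right mult_1)
  qed
  obtain n where n: "x = (\<Sum>b\<in>back_arcs. real (n b) * arrival b)"
    using assms by (auto simp: return_times_def)
  have "(\<Sum>b\<in>B. real (n b) * arrival b) \<in> ?C" if "finite B" "B \<subseteq> back_arcs" for B
    using that
  proof (induction B rule: finite_induct)
    case empty then show ?case using zero by simp
  next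
    case (insert b B)
    have "arrival b \<in> ?C"
      using insert.prems awalk_return_cycle[of b] cost_return_cycle[of b, symmetric] by blast
    then have "real (n b) * arrival b + (\<Sum>b\<in>B. real (n b) * arrival b) \<in> ?C"
      using insert by (intro add mult) auto
    then show ?case using insert.hyps by simp
  qed
  then have "x \<in> ?C" unfolding n by simp
  then show ?thesis by blast
qed

lemma ex_awalk_cost_iff:
  assumes "v \<in> verts G"
  shows "(\<exists>p. awalk s p v \<and> awalk_cost t p = T) \<longleftrightarrow> T - depth v \<in> return_times"
proof
  assume "T - depth v \<in> return_times"
  then obtain p where "awalk s p s" "awalk_cost t p = T - depth v"
    using return_time_awalk by blast
  then show "\<exists>p. awalk s p v \<and> awalk_cost t p = T"
    using awalk_tree_walk[OF assms] by (intro exI[of _ "p @ tree_walk v"]) (auto simp: depth_def)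
qed (auto dest: awalk_cost_diff_depth)

text \<open>Only repeated vertices on the tree walk could prevent this. Shortening that walk to a
  simple path keeps it in the tree, so by uniqueness it was simple already.\<close>

lemma cycle_return_cycle:
  assumes b: "b \<in> back_arcs"
  shows "cycle (return_cycle b)"
proof -
  let ?v = "tail G b" and ?p = "tree_walk (tail G b)"
  have v: "?v \<in> verts G" using b by (simp add: back_arcs_def)
  have "cas s ?p ?v" using awalk_tree_walk[OF v] by blast
  obtain q where "apath s q ?v" "set q \<subseteq> set ?p"
    using apath_awalk_to_apath[OF awalk_tree_walk[OF v]] awalk_to_apath_subset[OF awalk_tree_walk[OF v]]
    by blast
  then have "apath s ?p ?v"
    using tree_walk_unique[of q ?v] set_tree_walk[OF v] by (auto dest: awalkI_apath)
  then have "distinct (awalk_verts s ?p)" by (simp add: apath_def)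
  moreover have "awalk_verts s ?p = s # map (head G) ?p"
    using awalk_verts_conv'[OF \<open>cas s ?p ?v\<close>] \<open>cas s ?p ?v\<close> by (cases ?p) auto
  moreover have "awalk_verts s (return_cycle b) = tail G (hd (return_cycle b)) # map (head G) (return_cycle b)"
    using awalk_return_cycle[OF b]
    by (subst awalk_verts_conv') (auto simp: return_cycle_def)
  \<comment> \<open>The back arc ends in \<open>s\<close>, so the vertices after the first are those
    of the tree walk, with \<open>s\<close> moved from the front to the end.\<close>
  ultimately have "distinct (tl (awalk_verts s (return_cycle b)))"
    using head_back[of b] b by (simp add: return_cycle_def back_arcs_def)
  then show ?thesis using awalk_return_cycle[OF b] by (auto simp: cycle_def return_cycle_def)
qed

text \<open>Some arc of a cycle is a back arc, as otherwise a tree walk could be prolonged by the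
  cycle to a second one. There is only one, since all back arcs end in \<open>s\<close> and the
  heads on a cycle are distinct. Rotating it to the end leaves a tree walk in front.\<close>

lemma cycle_is_return_cycle:
  assumes "cycle p"
  shows "\<exists>b\<in>back_arcs. \<exists>k. return_cycle b = rotate k p"
proof -
  obtain u where u: "awalk u p u" "distinct (tl (awalk_verts u p))" "p \<noteq> []"
    using assms by (auto simp: cycle_def)
  have "cas u p u" "set p \<subseteq> arcs G" using u(1) by blast+
  then have heads: "distinct (map (head G) p)" using u(2,3) by (simp add: awalk_verts_conv')
  have "\<not> set p \<subseteq> arcs H"
  proof
    assume *: "set p \<subseteq> arcs H"
    have v: "u \<in> verts G" using u(1) by blast
    have "awalk s (tree_walk u @ p) u" using awalk_tree_walk[OF v] u(1) by (rule awalk_appendI)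
    then have "tree_walk u = tree_walk u @ p" using set_tree_walk[OF v] * by (intro tree_walk_unique) auto
    then show False using u(3) by simp
  qed
  then obtain b where b: "b \<in> set p" "b \<notin> arcs H" by blast
  then have b': "b \<in> back_arcs" using u(1) by (auto simp: back_arcs_def)
  obtain xs ys where p: "p = xs @ b # ys" using split_list[OF b(1)] by blast
  have "awalk u xs (tail G b)" "awalk s ys u"
    using u(1) head_back[of b] b' unfolding p by (auto simp: awalk_simps back_arcs_def)
  then have walk: "awalk s (ys @ xs) (tail G b)" by (intro awalk_appendI)
  have "set (ys @ xs) \<subseteq> arcs H"
  proof
    fix e assume e: "e \<in> set (ys @ xs)"
    show "e \<in> arcs H"
    proof (rule ccontr)
      assume "e \<notin> arcs H"
      then have "head G e = head G b"
        using e \<open>set p \<subseteq> arcs G\<close> head_back b' by (auto simp: p back_arcs_def)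
      moreover have "head G b \<notin> head G ` set (ys @ xs)" using heads by (auto simp: p)
      ultimately show False using e by (metis image_eqI)
    qed
  qed
  then have "return_cycle b = ys @ xs @ [b]"
    using tree_walk_unique[OF walk] by (simp add: return_cycle_def)
  moreover have "rotate (Suc (length xs)) p = ys @ xs @ [b]"
    using rotate_append[of "xs @ [b]" ys] by (simp add: p)
  ultimately have "return_cycle b = rotate (Suc (length xs)) p" by simp
  then show ?thesis using b' by blast
qed

lemma bij_betw_elementary_cycles:
  assumes "enumerates_elementary_cycles G \<beta> c"
  obtains f where "bij_betw f {1..\<beta>} back_arcs"
    "\<And>j. j \<in> {1..\<beta>} \<Longrightarrow> arrival (f j) = awalk_cost t (c j)"
proof -
  have cyc: "cycle (c j)" if "j \<in> {1..\<beta>}" for j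
    using assms that by (simp add: enumerates_elementary_cycles_def)
  have ex1: "\<exists>!j. j \<in> {1..\<beta>} \<and> (\<exists>k. p = rotate k (c j))" if "cycle p" for p
    using assms that unfolding enumerates_elementary_cycles_def by blast
  have "\<forall>j\<in>{1..\<beta>}. \<exists>b. b \<in> back_arcs \<and> (\<exists>k. return_cycle b = rotate k (c j))"
    using cycle_is_return_cycle[OF cyc] by blast
  then have "\<exists>f. \<forall>j\<in>{1..\<beta>}. f j \<in> back_arcs \<and> (\<exists>k. return_cycle (f j) = rotate k (c j))"
    by (rule bchoice)
  then obtain f where f: "\<And>j. j \<in> {1..\<beta>} \<Longrightarrow> f j \<in> back_arcs"
    "\<And>j. j \<in> {1..\<beta>} \<Longrightarrow> \<exists>k. return_cycle (f j) = rotate k (c j)"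
    by blast
  \<comment> \<open>A back arc can be recovered from the arc set of its return cycle, which rotation
    does not change.\<close>
  have only_back: "set (return_cycle b) \<inter> back_arcs = {b}" if "b \<in> back_arcs" for b
    using that set_tree_walk[of "tail G b"] by (auto simp: return_cycle_def back_arcs_def)
  show thesis
  proof
    show "bij_betw f {1..\<beta>} back_arcs"
      unfolding bij_betw_def
    proof
      show "inj_on f {1..\<beta>}"
      proof (rule inj_onI)
        fix i j assume "i \<in> {1..\<beta>}" "j \<in> {1..\<beta>}" "f i = f j"
        then show "i = j"
          using ex1[OF cycle_return_cycle[OF f(1)[of i]]] f(2)[of i] f(2)[of j] by auto
      qed
      show "f ` {1..\<beta>} = back_arcs"
      proof (intro equalityI subsetI)
        fix b assume b: "b \<in> back_arcs"
        then obtain j k where j: "j \<in> {1..\<beta>}" "return_cycle b = rotate k (c j)"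
          using ex1[OF cycle_return_cycle[OF b]] by blast
        then have "set (return_cycle (f j)) = set (return_cycle b)"
          using f(2)[OF j(1)] by (metis set_rotate)
        then have "f j = b" using only_back[OF b] only_back[OF f(1)[OF j(1)]] by auto
        then show "b \<in> f ` {1..\<beta>}" using j(1) by blast
      qed (use f(1) in auto)
    qed
  next
    fix j assume j: "j \<in> {1..\<beta>}"
    obtain k where "return_cycle (f j) = rotate k (c j)" using f(2)[OF j] by blast
    then have "mset (return_cycle (f j)) = mset (c j)"
      by (metis append_take_drop_id mset_append rotate_drop_take union_commute)
    then have "awalk_cost t (return_cycle (f j)) = awalk_cost t (c j)"
      unfolding awalk_cost_def by (metis mset_map sum_mset_sum_list)
    then show "arrival (f j) = awalk_cost t (c j)" by (simp add: cost_return_cycle)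
  qed
qed

subsection \<open>The number of endpoints\<close>

lemma return_times_below:
  "{x \<in> return_times. x < X} =
    (\<lambda>n. \<Sum>b\<in>back_arcs. real (n b) * arrival b) ` points_below arrival back_arcs X"
  by (auto simp: return_times_def points_below_def)

lemma finite_return_times_below: "finite {x \<in> return_times. x < X}"
  unfolding return_times_below
  by (intro finite_imageI finite_points_below) (auto simp: back_arcs_def arrival_pos)

lemma card_return_times_below:
  assumes "rat_independent_family back_arcs arrival"
  shows "real (card {x \<in> return_times. x < X}) = count_below arrival back_arcs X"
proof -
  have "inj_on (\<lambda>n. \<Sum>b\<in>back_arcs. real (n b) * arrival b) (points_below arrival back_arcs X)"
    using rat_independent_family_inj_combinations[OF assms]
    by (rule inj_on_subset) (auto simp: points_below_def)
  then show ?thesis unfolding return_times_below count_below_def by (simp add: card_image)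
qed

text \<open>Both counts are strict, so their difference covers the interval including
  \<open>x\<close> but not \<open>y\<close>; the left end is taken off separately.\<close>

lemma card_return_times_between:
  assumes "rat_independent_family back_arcs arrival" "x < y"
  shows "real (card {z \<in> return_times. x < z \<and> z < y}) =
    count_below arrival back_arcs y - count_below arrival back_arcs x - of_bool (x \<in> return_times)"
proof -
  let ?L = "{z \<in> return_times. z < x}" and ?M = "{z \<in> return_times. x < z \<and> z < y}"
    and ?E = "{x} \<inter> return_times"
  have fin: "finite ?L" "finite ?M" "finite ?E"
    using finite_return_times_below[of x] finite_return_times_below[of y]
    by (auto elim: rev_finite_subset)
  have "{z \<in> return_times. z < y} = ?L \<union> ?M \<union> ?E" using assms(2) by auto
  moreover have "card (?L \<union> ?M \<union> ?E) = card ?L + card ?M + card ?E"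
    using fin by (subst card_Un_disjoint; auto)+
  ultimately have "real (card {z \<in> return_times. z < y}) = card ?L + card ?M + card ?E" by simp
  moreover have "real (card ?E) = of_bool (x \<in> return_times)" by simp
  ultimately show ?thesis
    using card_return_times_below[OF assms(1), of x] card_return_times_below[OF assms(1), of y] by simp
qed

text \<open>A walker at distance \<open>x\<close> inside \<open>e\<close> was at the tail at time
  \<open>T - x\<close>, hence \<open>z = T - depth (tail G e) - x\<close> is a return time. The
  condition \<open>0 < x < t e\<close> becomes an open interval for \<open>z\<close>.\<close>

lemma card_interior_endpoints:
  fixes T :: real
  assumes ind: "rat_independent_family back_arcs arrival" and e: "e \<in> arcs G"
  defines "P \<equiv> {Interior_Point e x :: ('a, 'b) metric_graph_point | x p. 0 < x \<and> x < t e \<and> awalk s p (tail G e) \<and> awalk_cost t p + x = T}"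
  shows "finite P"
    and "real (card P) = count_below arrival back_arcs (T - depth (tail G e))
      - count_below arrival back_arcs (T - arrival e) - of_bool (T - arrival e \<in> return_times)"
proof -
  let ?M = "{z \<in> return_times. T - arrival e < z \<and> z < T - depth (tail G e)}"
  let ?f = "\<lambda>z. Interior_Point e (T - depth (tail G e) - z)"
  have "(\<exists>p. awalk s p (tail G e) \<and> awalk_cost t p + x = T) \<longleftrightarrow> T - depth (tail G e) - x \<in> return_times" for x
    using ex_awalk_cost_iff[of "tail G e" "T - x"] e by (simp add: algebra_simps)
  then have "P = {Interior_Point e x | x. 0 < x \<and> x < t e \<and> T - depth (tail G e) - x \<in> return_times}"
    unfolding P_def by blast
  also have "\<dots> = ?f ` ?M"
  proof (intro equalityI subsetI)
    fix q assume "q \<in> {Interior_Point e x | x. 0 < x \<and> x < t e \<and> T - depth (tail G e) - x \<in> return_times}"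
    then obtain x where "q = Interior_Point e x" "0 < x" "x < t e" "T - depth (tail G e) - x \<in> return_times"
      by blast
    then show "q \<in> ?f ` ?M" by (intro image_eqI[of _ _ "T - depth (tail G e) - x"]) (auto simp: arrival_def)
  qed (auto simp: arrival_def)
  finally have P: "P = ?f ` ?M" .
  have "finite ?M"
    using finite_return_times_below[of "T - depth (tail G e)"] by (auto elim: rev_finite_subset)
  then show "finite P" unfolding P by simp
  have "inj_on ?f ?M" by (auto simp: inj_on_def)
  then have "card P = card ?M" unfolding P by (rule card_image)
  then show "real (card P) = count_below arrival back_arcs (T - depth (tail G e))
      - count_below arrival back_arcs (T - arrival e) - of_bool (T - arrival e \<in> return_times)"
    using passage_time_pos[OF e] by (subst card_return_times_between[OF ind, symmetric]) (auto simp: arrival_def)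
qed

lemma sum_arcs_arrival:
  fixes g :: "real \<Rightarrow> real"
  shows "(\<Sum>e\<in>arcs G. g (arrival e)) = (\<Sum>v\<in>verts G - {s}. g (depth v)) + (\<Sum>b\<in>back_arcs. g (arrival b))"
proof -
  have "(\<Sum>e\<in>arcs H. g (arrival e)) = (\<Sum>e\<in>arcs H. g (depth (head G e)))"
    by (intro sum.cong) (simp_all add: depth_head)
  also have "\<dots> = (\<Sum>v\<in>verts G - {s}. g (depth v))"
    by (rule sum.reindex_bij_betw[OF bij_betw_head_tree])
  finally show ?thesis
    using sum.subset_diff[OF arcs_tree finite_arcs, of "\<lambda>e. g (arrival e)"] by (simp add: back_arcs_def)
qed

text \<open>Each arc loses a correction term at its far end, and each vertex reached at time
  \<open>T\<close> adds a point. By \<open>sum_arcs_arrival\<close> the tree arcs cancel the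
  vertices other than \<open>s\<close>, which leaves \<open>s\<close> and the back arcs.\<close>

lemma endpoint_count_eq:
  assumes ind: "rat_independent_family back_arcs arrival"
  shows "real (endpoint_count s T) =
    (\<Sum>e\<in>arcs G. count_below arrival back_arcs (T - depth (tail G e))
        - count_below arrival back_arcs (T - arrival e))
    + of_bool (T \<in> return_times) - (\<Sum>b\<in>back_arcs. of_bool (T - arrival b \<in> return_times))"
proof -
  let ?F = "count_below arrival back_arcs"
  define g :: "real \<Rightarrow> real" where "g d = of_bool (T - d \<in> return_times)" for d
  let ?V = "{Vertex_Point v :: ('a, 'b) metric_graph_point | v p. awalk s p v \<and> awalk_cost t p = T}"
  let ?P = "\<lambda>e. {Interior_Point e x :: ('a, 'b) metric_graph_point | x p.
      0 < x \<and> x < t e \<and> awalk s p (tail G e) \<and> awalk_cost t p + x = T}"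
  have V: "?V = Vertex_Point ` {v \<in> verts G. T - depth v \<in> return_times}"
    using ex_awalk_cost_iff by (auto dest: awalk_last_in_verts) 
  have finV: "finite ?V" unfolding V by simp
  have "real (card ?V) = (\<Sum>v\<in>verts G. g (depth v))"
    unfolding V by (subst card_image) (auto simp: inj_on_def g_def Int_def)
  also have "\<dots> = g 0 + (\<Sum>v\<in>verts G - {s}. g (depth v))"
    using source_in_verts depth_source by (simp add: sum.remove)
  finally have cardV: "real (card ?V) = g 0 + (\<Sum>v\<in>verts G - {s}. g (depth v))" .
  have "possible_endpoints s T = ?V \<union> (\<Union>e\<in>arcs G. ?P e)"
    unfolding possible_endpoints_def by blast
  moreover have "card (?V \<union> (\<Union>e\<in>arcs G. ?P e)) = card ?V + card (\<Union>e\<in>arcs G. ?P e)"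
    using card_interior_endpoints(1)[OF ind] by (intro card_Un_disjoint finV) auto
  moreover have "card (\<Union>e\<in>arcs G. ?P e) = (\<Sum>e\<in>arcs G. card (?P e))"
    using card_interior_endpoints(1)[OF ind] by (intro card_UN_disjoint) auto
  ultimately have "real (endpoint_count s T) = real (card ?V) + (\<Sum>e\<in>arcs G. real (card (?P e)))"
    by (simp add: endpoint_count_def)
  also have "(\<Sum>e\<in>arcs G. real (card (?P e))) =
      (\<Sum>e\<in>arcs G. ?F (T - depth (tail G e)) - ?F (T - arrival e) - g (arrival e))"
    unfolding g_def by (intro sum.cong refl card_interior_endpoints(2)[OF ind])
  also have "\<dots> = (\<Sum>e\<in>arcs G. ?F (T - depth (tail G e)) - ?F (T - arrival e)) - (\<Sum>e\<in>arcs G. g (arrival e))"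
    by (simp add: sum_subtractf)
  finally show ?thesis unfolding cardV sum_arcs_arrival by (simp add: g_def)
qed

section \<open>Asymptotics of the endpoint count, for several cycles and for a single one\<close>

lemma endpoint_count_asymp_several:
  assumes ind: "rat_independent_family back_arcs arrival" and card: "card back_arcs \<ge> 2"
  shows "((\<lambda>T. real (endpoint_count s T) / T ^ (card back_arcs - 1)) \<longlongrightarrow>
    (\<Sum>e\<in>arcs G. t e) * (1 / (fact (card back_arcs - 1) * (\<Prod>b\<in>back_arcs. arrival b)))) at_top"
proof -
  let ?F = "count_below arrival back_arcs" and ?m = "card back_arcs - 1"
  let ?K = "1 / (fact ?m * (\<Prod>b\<in>back_arcs. arrival b))"
  define r where "r T = of_bool (T \<in> return_times) - (\<Sum>b\<in>back_arcs. of_bool (T - arrival b \<in> return_times) :: real)" for T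
  obtain i j where ij: "i \<in> back_arcs" "j \<in> back_arcs" "i \<noteq> j"
    using card card_le_Suc0_iff_eq[OF finite_back_arcs] by fastforce
  have inc: "linear_increment ?F ?m ?K x" for x
    using rat_independent_family_irrational_ratio[OF ind ij] ij
    by (intro count_below_linear_increment) (auto simp: back_arcs_def arrival_pos)
  \<comment> \<open>The contribution of an arc is the difference of two increments that both start
    at \<open>T\<close>, of lengths \<open>arrival e\<close> and \<open>depth (tail G e)\<close>;
    their lengths differ by \<open>t e\<close>.\<close>
  have "((\<lambda>T. (?F T - ?F (T - arrival e)) / T ^ ?m - (?F T - ?F (T - depth (tail G e))) / T ^ ?m)
      \<longlongrightarrow> arrival e * ?K - depth (tail G e) * ?K) at_top" for e
    by (intro tendsto_diff inc[unfolded linear_increment_def])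
  then have arc: "((\<lambda>T. (?F (T - depth (tail G e)) - ?F (T - arrival e)) / T ^ ?m) \<longlongrightarrow> t e * ?K) at_top" for e
    by (simp add: arrival_def ring_distribs add_divide_distrib flip: diff_divide_distrib)
  have r: "((\<lambda>T. r T / T ^ ?m) \<longlongrightarrow> 0) at_top"
  proof (rule Lim_null_comparison)
    have bound: "\<bar>r T\<bar> \<le> 1 + real (card back_arcs)" for T
    proof -
      have "0 \<le> (\<Sum>b\<in>back_arcs. of_bool (T - arrival b \<in> return_times) :: real)"
        by (intro sum_nonneg) auto
      moreover have "(\<Sum>b\<in>back_arcs. of_bool (T - arrival b \<in> return_times) :: real) \<le> real (card back_arcs)"
        using sum_bounded_above[of back_arcs "\<lambda>b. of_bool (T - arrival b \<in> return_times) :: real" 1] by simp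
      moreover have "0 \<le> (of_bool (T \<in> return_times) :: real)" "(of_bool (T \<in> return_times) :: real) \<le> 1"
        by auto
      ultimately show ?thesis unfolding r_def by linarith
    qed
    show "\<forall>\<^sub>F T in at_top. norm (r T / T ^ ?m) \<le> (1 + real (card back_arcs)) / T ^ ?m"
      using eventually_gt_at_top[of 0] by eventually_elim (use bound in \<open>simp add: divide_right_mono\<close>)
    \<comment> \<open>With at least two back arcs the exponent is positive, so a bounded numerator
      is negligible.\<close>
    show "((\<lambda>T. (1 + real (card back_arcs)) / T ^ ?m) \<longlongrightarrow> 0) at_top"
      using card by (intro real_tendsto_divide_at_top[OF tendsto_const] filterlim_pow_at_top filterlim_ident) auto
  qed
  have "((\<lambda>T. (\<Sum>e\<in>arcs G. (?F (T - depth (tail G e)) - ?F (T - arrival e)) / T ^ ?m) + r T / T ^ ?m)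
      \<longlongrightarrow> (\<Sum>e\<in>arcs G. t e * ?K) + 0) at_top"
    by (intro tendsto_add tendsto_sum arc r)
  then show ?thesis
    by (simp add: endpoint_count_eq[OF ind] r_def sum_divide_distrib sum_distrib_right
        add_divide_distrib diff_divide_distrib add_diff_eq)
qed

text \<open>Strong connectivity gives every vertex an outgoing arc. A tree plus one back arc has as
  many arcs as vertices, so each vertex has exactly one.\<close>

lemma bij_betw_tail:
  assumes sc: "strongly_connected G" and b: "back_arcs = {b}"
  shows "bij_betw (tail G) (arcs G) (verts G)"
proof -
  have surj: "tail G ` arcs G = verts G"
  proof (intro equalityI subsetI)
    fix v assume v: "v \<in> verts G"
    then have "v \<rightarrow>\<^sup>* s" using sc source_in_verts by (simp add: strongly_connected_def)
    then obtain p where p: "awalk v p s" by (auto simp: reachable_awalk)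
    \<comment> \<open>Appending the return cycle makes the walk nonempty even when
      \<open>v = s\<close>, so that it has a first arc.\<close>
    have "awalk v (p @ return_cycle b) s"
      using p awalk_return_cycle[of b] b by (intro awalk_appendI) auto
    moreover obtain e q where "p @ return_cycle b = e # q"
      by (cases "p @ return_cycle b") (auto simp: return_cycle_def)
    ultimately show "v \<in> tail G ` arcs G" by (auto simp: awalk_Cons_iff)
  qed auto
  have "card (arcs G) = card (arcs H) + card back_arcs"
    unfolding back_arcs_def
    using arcs_tree finite_arcs by (metis card_Diff_subset card_mono le_add_diff_inverse finite_subset)
  also have "\<dots> = card (verts G)"
    using bij_betw_same_card[OF bij_betw_head_tree] source_in_verts b
    by (simp add: card_Suc_Diff1 del: card_Diff_insert)
  finally have "inj_on (tail G) (arcs G)" by (intro eq_card_imp_inj_on) (simp_all add: surj)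
  with surj show ?thesis by (simp add: bij_betw_def)
qed

text \<open>Every vertex has one outgoing arc, so sums of differences along the arcs telescope
  around the cycle. With the negation function this gives its length; with the counting function it
  leaves one increment over a full round, which is 1.\<close>

lemma endpoint_count_single:
  assumes sc: "strongly_connected G" and ind: "rat_independent_family back_arcs arrival"
    and b: "back_arcs = {b}"
  shows "(\<Sum>e\<in>arcs G. t e) = arrival b" and "T > 0 \<Longrightarrow> endpoint_count s T = 1"
proof -
  let ?F = "count_below arrival back_arcs"
  have telescope: "(\<Sum>e\<in>arcs G. g (depth (tail G e)) - g (arrival e)) = g 0 - g (arrival b)" for g :: "real \<Rightarrow> real"
    using source_in_verts
    by (simp add: sum_subtractf sum_arcs_arrival b depth_source sum.remove[of "verts G" s]
        sum.reindex_bij_betw[OF bij_betw_tail[OF sc b], of "\<lambda>v. g (depth v)"])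
  have "(\<Sum>e\<in>arcs G. t e) = (\<Sum>e\<in>arcs G. (- depth (tail G e)) - (- arrival e))"
    by (simp add: arrival_def)
  also have "\<dots> = arrival b" using telescope[of uminus] by simp
  finally show "(\<Sum>e\<in>arcs G. t e) = arrival b" .
  assume T: "T > 0"
  have arr: "arrival b > 0" using b by (intro arrival_pos) (auto simp: back_arcs_def)
  \<comment> \<open>A positive return time contains at least one round, and one can be removed.
    Hence the two correction terms in \<open>endpoint_count_eq\<close> cancel.\<close>
  have "T - arrival b \<in> return_times" if return: "T \<in> return_times"
  proof -
    obtain n where n: "T = real (n b) * arrival b" using return by (auto simp: return_times_def b)
    with T obtain k where "n b = Suc k" by (cases "n b") auto
    then show ?thesis using n unfolding return_times_def b
      by (intro CollectI exI[of _ "(\<lambda>_. 0)(b := k)"]) (auto simp: algebra_simps)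
  qed
  then have "T \<in> return_times \<longleftrightarrow> T - arrival b \<in> return_times"
    using return_times_add_arrival[of "T - arrival b" b] b by auto
  moreover have "?F T - ?F (T - arrival b) = 1"
    using count_below_insert[of "{}" b arrival T] arr T by (simp add: b count_below_empty)
  ultimately have "real (endpoint_count s T) = 1"
    using telescope[of "\<lambda>d. ?F (T - d)"] by (simp add: endpoint_count_eq[OF ind] b)
  then show "endpoint_count s T = 1" by simp
qed

lemma endpoint_count_asymp:
  assumes sc: "strongly_connected G" and ind: "rat_independent_family back_arcs arrival"
    and card: "card back_arcs \<ge> 1"
  shows "((\<lambda>T. real (endpoint_count s T) / T ^ (card back_arcs - 1)) \<longlongrightarrow>
    (\<Sum>e\<in>arcs G. t e) * (1 / (fact (card back_arcs - 1) * (\<Prod>b\<in>back_arcs. arrival b)))) at_top"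
proof (cases "card back_arcs \<ge> 2")
  case True
  with ind show ?thesis by (rule endpoint_count_asymp_several)
next
  case False
  with card have "card back_arcs = 1" by simp
  then obtain b where b: "back_arcs = {b}" by (rule card_1_singletonE)
  have "b \<in> arcs G" using b by (auto simp: back_arcs_def)
  then have "arrival b \<noteq> 0" using arrival_pos[of b] by simp
  moreover have "\<forall>\<^sub>F T in at_top. real (endpoint_count s T) = 1"
    using eventually_gt_at_top[of 0] by eventually_elim (simp add: endpoint_count_single(2)[OF sc ind b])
  \<comment> \<open>The exponent is 0 and the limit is
    \<open>arrival b / arrival b = 1\<close>.\<close>
  ultimately show ?thesis
    using endpoint_count_single(1)[OF sc ind b] by (simp add: b tendsto_eventually)
qed

end

section \<open>From back arcs to elementary cycles, and from the limit to the relative error\<close>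

theorem theorem2:
  fixes G :: "('a, 'b) pre_digraph"
    and t :: "'b \<Rightarrow> real"
    and s :: 'a
    and \<beta> :: nat
    and c :: "nat \<Rightarrow> 'b awalk"
    and l :: "'a \<Rightarrow> 'b awalk"
  assumes sperner: "one_way_sperner_graph G t s"
    and beta: "\<beta> \<ge> 1"
    and cycles: "enumerates_elementary_cycles G \<beta> c"
    and chains: "\<And>v. v \<in> verts G - {s} \<Longrightarrow> pre_digraph.apath G s (l v) v"
    and independent:
      "rat_independent_family ({1..\<beta>} <+> (verts G - {s}))
         (case_sum (\<lambda>j. wf_digraph.awalk_cost t (c j)) (\<lambda>v. wf_digraph.awalk_cost t (l v)))"
  shows "\<exists>r :: real \<Rightarrow> real. r \<in> o[at_top](\<lambda>_. 1) \<and>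
    (\<forall>\<^sub>F T in at_top.
       real (directed_metric_graph.endpoint_count G t s T) =
         T ^ (\<beta> - 1) / fact (\<beta> - 1) *
         ((\<Sum>e \<in> arcs G. t e) / (\<Prod>j = 1..\<beta>. wf_digraph.awalk_cost t (c j))) * (1 + r T))"
proof -
  interpret one_way_sperner_graph G t s by (rule sperner)
  obtain H where H: "spanning H G" "out_tree H s" "\<forall>e \<in> arcs G - arcs H. head G e = s"
    using tree_plus_arcs_to_source by blast
  interpret sperner_tree G t s H by unfold_locales (use H in auto)
  obtain f where f: "bij_betw f {1..\<beta>} back_arcs"
    and cost: "\<And>j. j \<in> {1..\<beta>} \<Longrightarrow> arrival (f j) = awalk_cost t (c j)"
    using bij_betw_elementary_cycles[OF cycles] by blast
  have card: "card back_arcs = \<beta>" using bij_betw_same_card[OF f] by simp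
  define P where "P = (\<Prod>j = 1..\<beta>. awalk_cost t (c j))"
  define S where "S = (\<Sum>e\<in>arcs G. t e)"
  define N where "N T = real (endpoint_count s T)" for T
  define L where "L = S * (1 / (fact (\<beta> - 1) * P))"
  \<comment> \<open>Maps a back arc to the index of the cycle that it closes; composed with
    \<open>Inl\<close> it lands in the cycle half of the independent family.\<close>
  let ?g = "inv_into {1..\<beta>} f"
  have g: "bij_betw ?g back_arcs {1..\<beta>}" using f by (rule bij_betw_inv_into)
  have "rat_independent_family back_arcs arrival"
  proof (rule rat_independent_family_comp[OF independent])
    show "inj_on (Inl \<circ> ?g) back_arcs" using g by (auto simp: bij_betw_def intro!: comp_inj_on)
    show "(Inl \<circ> ?g) ` back_arcs \<subseteq> {1..\<beta>} <+> (verts G - {s})"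
      using g by (auto simp: bij_betw_def)
    fix b assume b: "b \<in> back_arcs"
    then show "arrival b = case_sum (\<lambda>j. awalk_cost t (c j)) (\<lambda>v. awalk_cost t (l v)) ((Inl \<circ> ?g) b)"
      using cost[of "?g b"] bij_betw_apply[OF g b] bij_betw_inv_into_right[OF f b] by simp
  qed
  moreover have "(\<Prod>b\<in>back_arcs. arrival b) = P"
    unfolding P_def using cost by (simp add: prod.reindex_bij_betw[OF f, symmetric])
  ultimately have lim: "((\<lambda>T. N T / T ^ (\<beta> - 1)) \<longlongrightarrow> L) at_top"
    using endpoint_count_asymp[OF strongly_connected] beta by (simp add: card L_def N_def S_def)
  have "P > 0"
    unfolding P_def using cost bij_betw_apply[OF f] arrival_pos
    by (intro prod_pos) (metis DiffD1 back_arcs_def)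
  moreover have "S > 0"
  proof -
    have "arcs G \<noteq> {}" using beta card by (auto simp: back_arcs_def)
    then show ?thesis unfolding S_def by (intro sum_pos) (auto simp: passage_time_pos)
  qed
  ultimately have L: "L > 0" by (simp add: L_def)
  \<comment> \<open>The relative error against the leading term
    \<open>L * T ^ (\<beta> - 1)\<close>; positivity of \<open>L\<close> permits the
    division.\<close>
  define r where "r T = N T / T ^ (\<beta> - 1) / L - 1" for T
  have "(r \<longlongrightarrow> L / L - 1) at_top"
    unfolding r_def using L by (intro tendsto_intros lim) auto
  then have "r \<in> o[at_top](\<lambda>_. 1)" using L by (intro smalloI_tendsto) auto
  moreover have "\<forall>\<^sub>F T in at_top. N T = T ^ (\<beta> - 1) / fact (\<beta> - 1) * (S / P) * (1 + r T)"
    using eventually_gt_at_top[of 0]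
  proof eventually_elim
    case (elim T)
    have "T ^ (\<beta> - 1) / fact (\<beta> - 1) * (S / P) = T ^ (\<beta> - 1) * L" by (simp add: L_def)
    then show ?case using elim L by (simp add: r_def)
  qed
  ultimately show ?thesis unfolding N_def S_def P_def by blast
qed

end
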